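(* Let $(A,\cdot,[\cdot,\cdot,\cdot])$ be a (finite-dimensional) Poisson 3-Lie algebra over a field $\mathbb F$ of characteristic zero and let $V$ be a finite-dimensional vector space. Let $\mu:A\to\mathfrak{gl}(V)$ and $\rho:\otimes^2A\to\mathfrak{gl}(V)$ be linear maps. Then $(V,\rho,\mu)$ is a representation of the Poisson 3-Lie algebra $(A,\cdot,[\cdot,\cdot,\cdot])$ if and only if $(A\oplus V,\cdot_\mu,[\cdot,\cdot,\cdot]_\rho)$ is a Poisson 3-Lie algebra, where for all $x_1,x_2,x_3\in A$, $u_1,u_2,u_3\in V$, $$(x_1+u_1)\cdot_\mu(x_2+u_2)=x_1\cdot x_2+\mu(x_1)u_2+\mu(x_2)u_1,$$ $$[x_1+u_1,x_2+u_2,x_3+u_3]_\rho=[x_1,x_2,x_3]+\rho(x_1,x_2)u_3-\rho(x_1,x_3)u_2+\rho(x_2,x_3)u_1.$$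
   Context: 3-Lie algebra: vector space with a skew-symmetric trilinear bracket satisfying $[x_1,x_2,[x_3,x_4,x_5]]=[[x_1,x_2,x_3],x_4,x_5]+[x_3,[x_1,x_2,x_4],x_5]+[x_3,x_4,[x_1,x_2,x_5]]$. Poisson 3-Lie algebra $(A,\cdot,[\cdot,\cdot,\cdot])$: $(A,\cdot)$ commutative associative (no unit assumed), $(A,[\cdot,\cdot,\cdot])$ a 3-Lie algebra, and $[w\cdot x,y,z]=w\cdot[x,y,z]+x\cdot[w,y,z]$. A representation of a commutative associative algebra $(A,\cdot)$ on $V$: linear $\mu:A\to\mathfrak{gl}(V)$ with $\mu(x\cdot y)=\mu(x)\mu(y)$. A representation of a 3-Lie algebra on $V$: a skew-symmetric linear $\rho:\otimes^2A\to\mathfrak{gl}(V)$ with $\rho(x_1,x_2)\rho(x_3,x_4)-\rho(x_3,x_4)\rho(x_1,x_2)=\rho([x_1,x_2,x_3],x_4)-\rho([x_1,x_2,x_4],x_3)$ and $\rho([x_1,x_2,x_3],x_4)=\rho(x_1,x_2)\rho(x_3,x_4)+\rho(x_2,x_3)\rho(x_1,x_4)+\rho(x_3,x_1)\rho(x_2,x_4)$. A representation $(V,\rho,\mu)$ of a Poisson 3-Lie algebra: $(V,\mu)$ is a representation of $(A,\cdot)$, $(V,\rho)$ is a representation of $(A,[\cdot,\cdot,\cdot])$, and $\rho(x\cdot y,z)=\mu(x)\rho(y,z)+\mu(y)\rho(x,z)$, $\rho(x,y)\mu(z)=\mu([x,y,z])+\mu(z)\rho(x,y)$ for all $x,y,z\in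 A$. *)

theory Defs
  imports "HOL-Analysis.Product_Vector"
begin

text \<open>Algebras live on whole types that are vector spaces for an explicit scalar multiplication.\<close>

definition bilinear_op :: "('f::field \<Rightarrow> 'a::ab_group_add \<Rightarrow> 'a) \<Rightarrow> ('a \<Rightarrow> 'a \<Rightarrow> 'a) \<Rightarrow> bool"
  where "bilinear_op s m \<longleftrightarrow>
    (\<forall>y. Vector_Spaces.linear s s (\<lambda>x. m x y)) \<and>
    (\<forall>x. Vector_Spaces.linear s s (\<lambda>y. m x y))"

definition trilinear_op ::
    "('f::field \<Rightarrow> 'a::ab_group_add \<Rightarrow> 'a) \<Rightarrow> ('a \<Rightarrow> 'a \<Rightarrow> 'a \<Rightarrow> 'a) \<Rightarrow> bool"
  where "trilinear_op s b \<longleftrightarrow>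
    (\<forall>y z. Vector_Spaces.linear s s (\<lambda>x. b x y z)) \<and>
    (\<forall>x z. Vector_Spaces.linear s s (\<lambda>y. b x y z)) \<and>
    (\<forall>x y. Vector_Spaces.linear s s (\<lambda>z. b x y z))"

locale comm_assoc_algebra =
  vector_space scale + abel_semigroup mult
  for scale :: "'f::field \<Rightarrow> 'a::ab_group_add \<Rightarrow> 'a"
    and mult :: "'a \<Rightarrow> 'a \<Rightarrow> 'a" +
  assumes bilinear_mult: "bilinear_op scale mult"

text \<open>Skew-symmetry under all permutations is expressed by the two adjacent
  transpositions, which generate the symmetric group on three letters.\<close>

locale three_lie_algebra =
  vector_space scale
  for scale :: "'f::field \<Rightarrow> 'a::ab_group_add \<Rightarrow> 'a" +
  fixes bracket :: "'a \<Rightarrow> 'a \<Rightarrow> 'a \<Rightarrow> 'a"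
  assumes trilinear_bracket: "trilinear_op scale bracket"
    and skew_12: "bracket y x z = - bracket x y z"
    and skew_23: "bracket x z y = - bracket x y z"
    and fundamental_identity:
      "bracket x1 x2 (bracket x3 x4 x5) =
         bracket (bracket x1 x2 x3) x4 x5
       + bracket x3 (bracket x1 x2 x4) x5
       + bracket x3 x4 (bracket x1 x2 x5)"

locale poisson_three_lie_algebra =
  comm_assoc_algebra scale mult + three_lie_algebra scale bracket
  for scale :: "'f::field \<Rightarrow> 'a::ab_group_add \<Rightarrow> 'a"
    and mult :: "'a \<Rightarrow> 'a \<Rightarrow> 'a"
    and bracket :: "'a \<Rightarrow> 'a \<Rightarrow> 'a \<Rightarrow> 'a" +
  assumes leibniz:
    "bracket (mult w x) y z = mult w (bracket x y z) + mult x (bracket w y z)"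

text \<open>A linear map from \<open>A\<close> to \<open>gl(V)\<close>: the values are linear endomorphisms of \<open>V\<close>, and the
  dependence on \<open>x\<close> is linear for the pointwise vector space structure on endomorphisms.\<close>

definition linear_to_gl ::
    "('f::field \<Rightarrow> 'a::ab_group_add \<Rightarrow> 'a) \<Rightarrow> ('f \<Rightarrow> 'v::ab_group_add \<Rightarrow> 'v) \<Rightarrow>
     ('a \<Rightarrow> 'v \<Rightarrow> 'v) \<Rightarrow> bool"
  where "linear_to_gl sA sV \<mu> \<longleftrightarrow>
    (\<forall>x. Vector_Spaces.linear sV sV (\<mu> x)) \<and>
    (\<forall>u. Vector_Spaces.linear sA sV (\<lambda>x. \<mu> x u))"

text \<open>A linear map from \<open>A \<otimes> A\<close> to \<open>gl(V)\<close>, given as the corresponding bilinear map on \<open>A \<times> A\<close>.\<close>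

definition tensor2_linear_to_gl ::
    "('f::field \<Rightarrow> 'a::ab_group_add \<Rightarrow> 'a) \<Rightarrow> ('f \<Rightarrow> 'v::ab_group_add \<Rightarrow> 'v) \<Rightarrow>
     ('a \<Rightarrow> 'a \<Rightarrow> 'v \<Rightarrow> 'v) \<Rightarrow> bool"
  where "tensor2_linear_to_gl sA sV \<rho> \<longleftrightarrow>
    (\<forall>y. linear_to_gl sA sV (\<lambda>x. \<rho> x y)) \<and>
    (\<forall>x. linear_to_gl sA sV (\<lambda>y. \<rho> x y))"

locale comm_assoc_rep =
  A: comm_assoc_algebra sA mult + V: vector_space sV
  for sA :: "'f::field \<Rightarrow> 'a::ab_group_add \<Rightarrow> 'a"
    and mult :: "'a \<Rightarrow> 'a \<Rightarrow> 'a"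
    and sV :: "'f \<Rightarrow> 'v::ab_group_add \<Rightarrow> 'v" +
  fixes \<mu> :: "'a \<Rightarrow> 'v \<Rightarrow> 'v"
  assumes linear_mu: "linear_to_gl sA sV \<mu>"
    and mu_mult: "\<mu> (mult x y) u = \<mu> x (\<mu> y u)"

locale three_lie_rep =
  A: three_lie_algebra sA bracket + V: vector_space sV
  for sA :: "'f::field \<Rightarrow> 'a::ab_group_add \<Rightarrow> 'a"
    and bracket :: "'a \<Rightarrow> 'a \<Rightarrow> 'a \<Rightarrow> 'a"
    and sV :: "'f \<Rightarrow> 'v::ab_group_add \<Rightarrow> 'v" +
  fixes \<rho> :: "'a \<Rightarrow> 'a \<Rightarrow> 'v \<Rightarrow> 'v"
  assumes linear_rho: "tensor2_linear_to_gl sA sV \<rho>"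
    and skew_rho: "\<rho> y x u = - \<rho> x y u"
    and rho_commutator:
      "\<rho> x1 x2 (\<rho> x3 x4 u) - \<rho> x3 x4 (\<rho> x1 x2 u) =
         \<rho> (bracket x1 x2 x3) x4 u - \<rho> (bracket x1 x2 x4) x3 u"
    and rho_bracket:
      "\<rho> (bracket x1 x2 x3) x4 u =
         \<rho> x1 x2 (\<rho> x3 x4 u) + \<rho> x2 x3 (\<rho> x1 x4 u) + \<rho> x3 x1 (\<rho> x2 x4 u)"

locale poisson_three_lie_rep =
  A: poisson_three_lie_algebra sA mult bracket +
  comm_assoc_rep sA mult sV \<mu> + three_lie_rep sA bracket sV \<rho>
  for sA :: "'f::field \<Rightarrow> 'a::ab_group_add \<Rightarrow> 'a"
    and mult :: "'a \<Rightarrow> 'a \<Rightarrow> 'a"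
    and bracket :: "'a \<Rightarrow> 'a \<Rightarrow> 'a \<Rightarrow> 'a"
    and sV :: "'f \<Rightarrow> 'v::ab_group_add \<Rightarrow> 'v"
    and \<rho> :: "'a \<Rightarrow> 'a \<Rightarrow> 'v \<Rightarrow> 'v"
    and \<mu> :: "'a \<Rightarrow> 'v \<Rightarrow> 'v" +
  assumes rho_mult: "\<rho> (mult x y) z u = \<mu> x (\<rho> y z u) + \<mu> y (\<rho> x z u)"
    and rho_mu: "\<rho> x y (\<mu> z u) = \<mu> (bracket x y z) u + \<mu> z (\<rho> x y u)"

text \<open>The direct sum \<open>A \<oplus> V\<close> is the product type, with \<open>x + u\<close> written \<open>(x, u)\<close> and scalar
  multiplication \<^const>\<open>module_prod.scale\<close>.\<close>

fun semidirect_mult ::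
    "('a \<Rightarrow> 'a \<Rightarrow> 'a) \<Rightarrow> ('a \<Rightarrow> 'v \<Rightarrow> 'v::ab_group_add) \<Rightarrow> 'a \<times> 'v \<Rightarrow> 'a \<times> 'v \<Rightarrow> 'a \<times> 'v"
  where "semidirect_mult mult \<mu> (x1, u1) (x2, u2) = (mult x1 x2, \<mu> x1 u2 + \<mu> x2 u1)"

fun semidirect_bracket ::
    "('a \<Rightarrow> 'a \<Rightarrow> 'a \<Rightarrow> 'a) \<Rightarrow> ('a \<Rightarrow> 'a \<Rightarrow> 'v \<Rightarrow> 'v::ab_group_add) \<Rightarrow>
     'a \<times> 'v \<Rightarrow> 'a \<times> 'v \<Rightarrow> 'a \<times> 'v \<Rightarrow> 'a \<times> 'v"
  where "semidirect_bracket bracket \<rho> (x1, u1) (x2, u2) (x3, u3) =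
    (bracket x1 x2 x3, \<rho> x1 x2 u3 - \<rho> x1 x3 u2 + \<rho> x2 x3 u1)"

end

theory Submission
  imports Defs
begin

text \<open>
  The operations of \<open>A \<oplus> V\<close> restrict to those of \<open>A\<close>, vanish as soon as two arguments lie in \<open>V\<close>,
  and recover \<open>\<mu>\<close> and \<open>\<rho>\<close> when exactly one argument does. By multilinearity each axiom of
  \<open>A \<oplus> V\<close> therefore splits into the axiom for \<open>A\<close> and one identity for each position of the
  single argument from \<open>V\<close>; up to skew-symmetry these identities are the representation axioms.
\<close>

lemma linear_addD: "Vector_Spaces.linear s1 s2 f \<Longrightarrow> f (x + y) = f x + f y"
  and linear_scaleD: "Vector_Spaces.linear s1 s2 f \<Longrightarrow> f (s1 c x) = s2 c (f x)"
  and linear_zeroD: "Vector_Spaces.linear s1 s2 f \<Longrightarrow> f 0 = 0"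
  and linear_minusD: "Vector_Spaces.linear s1 s2 f \<Longrightarrow> f (- x) = - f x"
  and linear_diffD: "Vector_Spaces.linear s1 s2 f \<Longrightarrow> f (x - y) = f x - f y"
  by (simp_all add: linear_iff_module_hom module_hom.add module_hom.scale module_hom.zero
      module_hom.neg module_hom.diff)

context comm_assoc_algebra
begin

lemma linear_mult: "Vector_Spaces.linear scale scale (\<lambda>x. mult x y)"
    "Vector_Spaces.linear scale scale (mult x)"
  using bilinear_mult by (simp_all add: bilinear_op_def)

lemmas mult_simps = linear_mult[THEN linear_addD] linear_mult[THEN linear_scaleD]
  linear_mult[THEN linear_zeroD]

end

context three_lie_algebra
begin

lemma linear_bracket: "Vector_Spaces.linear scale scale (\<lambda>x. bracket x y z)"
    "Vector_Spaces.linear scale scale (\<lambda>y. bracket x y z)"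
    "Vector_Spaces.linear scale scale (bracket x y)"
  using trilinear_bracket by (simp_all add: trilinear_op_def)

lemmas bracket_simps = linear_bracket[THEN linear_addD] linear_bracket[THEN linear_scaleD]
  linear_bracket[THEN linear_zeroD]

end

text \<open>This is \<open>comm_assoc_rep\<close> without multiplicativity of \<open>\<mu>\<close>:
  exactly what both sides of the equivalence may presuppose, so bilinearity of the semidirect
  product is settled before either side is assumed.\<close>

locale comm_assoc_linear_action =
  A: comm_assoc_algebra sA mult + V: vector_space sV
  for sA :: "'f::field \<Rightarrow> 'a::ab_group_add \<Rightarrow> 'a"
    and mult :: "'a \<Rightarrow> 'a \<Rightarrow> 'a"
    and sV :: "'f \<Rightarrow> 'v::ab_group_add \<Rightarrow> 'v" +
  fixes \<mu> :: "'a \<Rightarrow> 'v \<Rightarrow> 'v"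
  assumes linear_mu: "linear_to_gl sA sV \<mu>"
begin

sublocale prod: vector_space_prod sA sV ..

lemma linear_mu_arg: "Vector_Spaces.linear sV sV (\<mu> x)"
    "Vector_Spaces.linear sA sV (\<lambda>x. \<mu> x u)"
  using linear_mu by (simp_all add: linear_to_gl_def)

lemmas mu_simps = linear_mu_arg[THEN linear_addD] linear_mu_arg[THEN linear_scaleD]
  linear_mu_arg[THEN linear_zeroD] linear_mu_arg[THEN linear_minusD]
  linear_mu_arg[THEN linear_diffD]

lemma bilinear_semidirect_mult: "bilinear_op prod.scale (semidirect_mult mult \<mu>)"
  unfolding bilinear_op_def Vector_Spaces.linear_iff
  by (auto simp: prod.p.vector_space_axioms prod.scale_prod A.mult_simps mu_simps
      V.scale_right_distrib)

text \<open>Associativity with the vector in the last place is multiplicativity of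
  \<open>\<mu>\<close>; the other two places then follow because the operators
  \<open>\<mu> x\<close> commute.\<close>

theorem comm_assoc_semidirect_iff:
  "comm_assoc_rep sA mult sV \<mu> \<longleftrightarrow>
    comm_assoc_algebra prod.scale (semidirect_mult mult \<mu>)"
proof
  assume "comm_assoc_rep sA mult sV \<mu>"
  then interpret R: comm_assoc_rep sA mult sV \<mu> .
  \<comment> \<open>Both composites are the action of one product, as \<open>mult\<close> is
    commutative. This handles associativity with the vector in the first or middle place.\<close>
  have mu_swap: "\<mu> x (\<mu> y u) = \<mu> y (\<mu> x u)" for x y u
    by (metis R.mu_mult A.commute)
  show "comm_assoc_algebra prod.scale (semidirect_mult mult \<mu>)"
  proof unfold_locales
    show "semidirect_mult mult \<mu> (semidirect_mult mult \<mu> a b) c =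
        semidirect_mult mult \<mu> a (semidirect_mult mult \<mu> b c)" for a b c
      by (cases a; cases b; cases c)
        (simp add: A.assoc R.mu_mult mu_simps mu_swap ac_simps)
    show "semidirect_mult mult \<mu> a b = semidirect_mult mult \<mu> b a" for a b
      by (cases a; cases b) (simp add: A.commute add.commute)
  qed (rule bilinear_semidirect_mult)
next
  assume "comm_assoc_algebra prod.scale (semidirect_mult mult \<mu>)"
  then interpret S: comm_assoc_algebra prod.scale "semidirect_mult mult \<mu>" .
  show "comm_assoc_rep sA mult sV \<mu>"
  proof unfold_locales
    show "\<mu> (mult x y) u = \<mu> x (\<mu> y u)" for x y u
      using S.assoc[of "(x, 0)" "(y, 0)" "(0, u)"] by (simp add: mu_simps)
  qed (rule linear_mu)
qed

end

text \<open>Here only bilinearity of \<open>\<rho>\<close> is kept. Skew-symmetry is left out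
  because in one direction it has to be derived from that of the semidirect bracket.\<close>

locale three_lie_linear_action =
  A: three_lie_algebra sA bracket + V: vector_space sV
  for sA :: "'f::field \<Rightarrow> 'a::ab_group_add \<Rightarrow> 'a"
    and bracket :: "'a \<Rightarrow> 'a \<Rightarrow> 'a \<Rightarrow> 'a"
    and sV :: "'f \<Rightarrow> 'v::ab_group_add \<Rightarrow> 'v" +
  fixes \<rho> :: "'a \<Rightarrow> 'a \<Rightarrow> 'v \<Rightarrow> 'v"
  assumes linear_rho: "tensor2_linear_to_gl sA sV \<rho>"
begin

sublocale prod: vector_space_prod sA sV ..

lemma linear_rho_arg: "Vector_Spaces.linear sV sV (\<rho> x y)"
    "Vector_Spaces.linear sA sV (\<lambda>x. \<rho> x y u)"
    "Vector_Spaces.linear sA sV (\<lambda>y. \<rho> x y u)"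
  using linear_rho by (simp_all add: tensor2_linear_to_gl_def linear_to_gl_def)

lemmas rho_simps = linear_rho_arg[THEN linear_addD] linear_rho_arg[THEN linear_scaleD]
  linear_rho_arg[THEN linear_zeroD] linear_rho_arg[THEN linear_minusD]
  linear_rho_arg[THEN linear_diffD]

lemma trilinear_semidirect_bracket: "trilinear_op prod.scale (semidirect_bracket bracket \<rho>)"
  unfolding trilinear_op_def Vector_Spaces.linear_iff
  by (auto simp: prod.p.vector_space_axioms prod.scale_prod A.bracket_simps rho_simps
      V.scale_right_distrib V.scale_right_diff_distrib)

text \<open>The fundamental identity has five places for the vector. Up to skew-symmetry, the first
  two give \<open>rho_bracket\<close> and the last three give \<open>rho_commutator\<close>.\<close>

theorem three_lie_semidirect_iff:
  "three_lie_rep sA bracket sV \<rho> \<longleftrightarrow>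
    three_lie_algebra prod.scale (semidirect_bracket bracket \<rho>)"
proof
  assume "three_lie_rep sA bracket sV \<rho>"
  then interpret R: three_lie_rep sA bracket sV \<rho> .
  \<comment> \<open>The two shapes of the fundamental identity with one argument in \<open>V\<close>: that argument is
    either outside or inside the inner bracket on the left-hand side.\<close>
  have outer: "\<rho> y (bracket x3 x4 x5) u =
      \<rho> x4 x5 (\<rho> y x3 u) - \<rho> x3 x5 (\<rho> y x4 u) + \<rho> x3 x4 (\<rho> y x5 u)" for y x3 x4 x5 u
    using R.rho_bracket[of x3 x4 x5 y u] R.skew_rho[of y "bracket x3 x4 x5" u]
      R.skew_rho[of y x3 u] R.skew_rho[of y x4 u] R.skew_rho[of y x5 u] R.skew_rho[of x3 x5]
    by (simp add: rho_simps)
  have inner: "\<rho> x1 x2 (\<rho> x3 x4 u) =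
      \<rho> (bracket x1 x2 x3) x4 u + \<rho> x3 (bracket x1 x2 x4) u + \<rho> x3 x4 (\<rho> x1 x2 u)"
    for x1 x2 x3 x4 u
    using R.rho_commutator[of x1 x2 x3 x4 u] R.skew_rho[of x3 "bracket x1 x2 x4" u]
    by (simp add: algebra_simps)
  show "three_lie_algebra prod.scale (semidirect_bracket bracket \<rho>)"
  proof unfold_locales
    show "semidirect_bracket bracket \<rho> b a c = - semidirect_bracket bracket \<rho> a b c" for a b c
      using A.skew_12[of "fst b" "fst a"] R.skew_rho[of "fst b" "fst a"]
      by (cases a; cases b; cases c) simp
    show "semidirect_bracket bracket \<rho> a c b = - semidirect_bracket bracket \<rho> a b c" for a b c
      using A.skew_23[of "fst a" "fst c" "fst b"] R.skew_rho[of "fst c" "fst b"]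
      by (cases a; cases b; cases c) simp
    show "semidirect_bracket bracket \<rho> a1 a2 (semidirect_bracket bracket \<rho> a3 a4 a5) =
        semidirect_bracket bracket \<rho> (semidirect_bracket bracket \<rho> a1 a2 a3) a4 a5 +
        semidirect_bracket bracket \<rho> a3 (semidirect_bracket bracket \<rho> a1 a2 a4) a5 +
        semidirect_bracket bracket \<rho> a3 a4 (semidirect_bracket bracket \<rho> a1 a2 a5)"
      for a1 a2 a3 a4 a5
    proof -
      obtain x1 u1 x2 u2 x3 u3 x4 u4 x5 u5
        where a: "a1 = (x1, u1)" "a2 = (x2, u2)" "a3 = (x3, u3)" "a4 = (x4, u4)" "a5 = (x5, u5)"
        by (metis prod.exhaust)
      show ?thesis
        unfolding a
        \<comment> \<open>One instance for each vector: \<open>outer\<close> treats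
          \<open>u1\<close> and \<open>u2\<close>, \<open>inner\<close> treats \<open>u3\<close>,
          \<open>u4\<close> and \<open>u5\<close>.\<close>
        using A.fundamental_identity[of x1 x2 x3 x4 x5] outer[of x1 x3 x4 x5 u2]
          outer[of x2 x3 x4 x5 u1] inner[of x1 x2 x4 x5 u3] inner[of x1 x2 x3 x5 u4]
          inner[of x1 x2 x3 x4 u5]
        by (simp add: rho_simps)
    qed
  qed (rule trilinear_semidirect_bracket)
next
  assume "three_lie_algebra prod.scale (semidirect_bracket bracket \<rho>)"
  then interpret S: three_lie_algebra prod.scale "semidirect_bracket bracket \<rho>" .
  have skew: "\<rho> y x u = - \<rho> x y u" for x y u
    using S.skew_12[of "(y, 0)" "(x, 0)" "(0, u)"] by (simp add: rho_simps)
  show "three_lie_rep sA bracket sV \<rho>"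
  proof unfold_locales
    show "\<rho> y x u = - \<rho> x y u" for x y u
      by (rule skew)
    show "\<rho> x1 x2 (\<rho> x3 x4 u) - \<rho> x3 x4 (\<rho> x1 x2 u) =
        \<rho> (bracket x1 x2 x3) x4 u - \<rho> (bracket x1 x2 x4) x3 u" for x1 x2 x3 x4 u
      \<comment> \<open>With the vector in the last place, one term has the inner bracket as second
        argument of \<open>\<rho>\<close>; skew-symmetry moves it to the first and produces the
        minus sign.\<close>
      using S.fundamental_identity[of "(x1, 0)" "(x2, 0)" "(x3, 0)" "(x4, 0)" "(0, u)"]
        skew[of "bracket x1 x2 x4" x3 u]
      by (simp add: rho_simps)
    show "\<rho> (bracket x1 x2 x3) x4 u =
        \<rho> x1 x2 (\<rho> x3 x4 u) + \<rho> x2 x3 (\<rho> x1 x4 u) + \<rho> x3 x1 (\<rho> x2 x4 u)" for x1 x2 x3 x4 u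
      \<comment> \<open>With the vector first, every term acts on \<open>u\<close> through some
        \<open>\<rho> x4 _\<close>. Swapping these arguments negates the whole identity, and
        \<open>skew[of x1 x3]\<close> absorbs the remaining minus sign.\<close>
      using S.fundamental_identity[of "(0, u)" "(x4, 0)" "(x1, 0)" "(x2, 0)" "(x3, 0)"]
        skew[of "bracket x1 x2 x3" x4 u] skew[of x1 x4 u] skew[of x2 x4 u] skew[of x3 x4 u]
        skew[of x1 x3]
      by (simp add: rho_simps)
  qed (rule linear_rho)
qed

end

theorem proposition4p4:
  fixes sA :: "'f::field_char_0 \<Rightarrow> 'a::ab_group_add \<Rightarrow> 'a"
    and sV :: "'f \<Rightarrow> 'v::ab_group_add \<Rightarrow> 'v"
    and BA :: "'a set" and BV :: "'v set"
    and mult :: "'a \<Rightarrow> 'a \<Rightarrow> 'a"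
    and bracket :: "'a \<Rightarrow> 'a \<Rightarrow> 'a \<Rightarrow> 'a"
    and \<mu> :: "'a \<Rightarrow> 'v \<Rightarrow> 'v"
    and \<rho> :: "'a \<Rightarrow> 'a \<Rightarrow> 'v \<Rightarrow> 'v"
  assumes "finite_dimensional_vector_space sA BA"
    and "finite_dimensional_vector_space sV BV"
    and "poisson_three_lie_algebra sA mult bracket"
    and "linear_to_gl sA sV \<mu>"
    and "tensor2_linear_to_gl sA sV \<rho>"
  shows "poisson_three_lie_rep sA mult bracket sV \<rho> \<mu> \<longleftrightarrow>
    poisson_three_lie_algebra (module_prod.scale sA sV)
      (semidirect_mult mult \<mu>) (semidirect_bracket bracket \<rho>)"
proof -
  interpret A: poisson_three_lie_algebra sA mult bracket by fact
  interpret V: finite_dimensional_vector_space sV BV by fact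
  interpret M: comm_assoc_linear_action sA mult sV \<mu>
    by unfold_locales fact
  interpret L: three_lie_linear_action sA bracket sV \<rho>
    by unfold_locales fact
  show ?thesis
  proof
    assume "poisson_three_lie_rep sA mult bracket sV \<rho> \<mu>"
    then interpret R: poisson_three_lie_rep sA mult bracket sV \<rho> \<mu> .
    interpret SM: comm_assoc_algebra "module_prod.scale sA sV" "semidirect_mult mult \<mu>"
      using M.comm_assoc_semidirect_iff R.comm_assoc_rep_axioms by blast
    interpret SL: three_lie_algebra "module_prod.scale sA sV" "semidirect_bracket bracket \<rho>"
      using L.three_lie_semidirect_iff R.three_lie_rep_axioms by blast
    \<comment> \<open>\<open>rho_mu\<close> yields \<open>\<mu> (bracket y z w)\<close>, whereas the
      Leibniz rule below contains \<open>\<mu> (bracket w y z)\<close>.\<close>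
    have rotate: "bracket x y z = bracket y z x" for x y z
      using A.skew_12[of x y z] A.skew_23[of y x z] by simp
    show "poisson_three_lie_algebra (module_prod.scale sA sV)
        (semidirect_mult mult \<mu>) (semidirect_bracket bracket \<rho>)"
    proof unfold_locales
      fix a b c d :: "'a \<times> 'v"
      obtain w p x q y r z s
        where a: "a = (w, p)" "b = (x, q)" "c = (y, r)" "d = (z, s)"
        by (metis prod.exhaust)
      show "semidirect_bracket bracket \<rho> (semidirect_mult mult \<mu> a b) c d =
          semidirect_mult mult \<mu> a (semidirect_bracket bracket \<rho> b c d) +
          semidirect_mult mult \<mu> b (semidirect_bracket bracket \<rho> a c d)"
        unfolding a
        \<comment> \<open>The vectors \<open>p\<close> and \<open>q\<close> of the two factors need
          \<open>rho_mu\<close>; \<open>r\<close> and \<open>s\<close> in the other bracket slots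
          need \<open>rho_mult\<close>.\<close>
        using R.rho_mu[of y z w q] R.rho_mu[of y z x p] rotate[of w y z] rotate[of x y z]
        by (simp add: A.leibniz R.rho_mult M.mu_simps L.rho_simps)
    qed
  next
    assume "poisson_three_lie_algebra (module_prod.scale sA sV)
        (semidirect_mult mult \<mu>) (semidirect_bracket bracket \<rho>)"
    then interpret S: poisson_three_lie_algebra "module_prod.scale sA sV"
        "semidirect_mult mult \<mu>" "semidirect_bracket bracket \<rho>" .
    interpret RM: comm_assoc_rep sA mult sV \<mu>
      using M.comm_assoc_semidirect_iff S.comm_assoc_algebra_axioms by blast
    interpret RL: three_lie_rep sA bracket sV \<rho>
      using L.three_lie_semidirect_iff S.three_lie_algebra_axioms by blast
    show "poisson_three_lie_rep sA mult bracket sV \<rho> \<mu>"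
    proof unfold_locales
      show "\<rho> (mult x y) z u = \<mu> x (\<rho> y z u) + \<mu> y (\<rho> x z u)" for x y z u
        \<comment> \<open>The vector stands outside the product here; for the second identity it is
          a factor of the product.\<close>
        using S.leibniz[of "(x, 0)" "(y, 0)" "(z, 0)" "(0, u)"]
        by (simp add: M.mu_simps L.rho_simps)
      show "\<rho> x y (\<mu> z u) = \<mu> (bracket x y z) u + \<mu> z (\<rho> x y u)" for x y z u
        using S.leibniz[of "(z, 0)" "(0, u)" "(x, 0)" "(y, 0)"]
          A.skew_12[of z x y] A.skew_23[of x z y]
        by (simp add: M.mu_simps L.rho_simps)
    qed
  qed
qed

end
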